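(* Let \(e^{zN}.F\) be a nilpotent orbit, and let \(z\) be such that \(e^{zN}.F\in\mathcal M\). Then, with respect to the mixed Hodge structure \((e^{zN}.F,W)\), the Hodge decomposition of \(N\) has the form \[N=N^{-1,1}+N^{0,0}+N^{1,-1}+\Big(\sum_{k>0}N^{-1,1-k}\Big)+\Big(\sum_{k>0}N^{0,-k}\Big),\] i.e. all other Hodge components \(N^{r,s}\) vanish.
   Context: \(V_{\mathbb Q}\) finite-dimensional over \(\mathbb Q\), \(V=V_{\mathbb Q}\otimes\mathbb C\), \(W\) an increasing rational filtration, \(Q=\{Q_k\}\) nondegenerate rational bilinear forms on \(Gr^W_k\) of parity \((-1)^k\); \(\mathcal M\) the set of decreasing filtrations (fixed \(\dim F^p\)) with \((F,W)\) a mixed Hodge structure graded-polarized by \(Q\); \(G_{\mathbb C}\) the automorphisms of \(V\) preserving \(W\) acting on \(Gr^W\) by complex automorphisms of \(Q\), \(\mathfrak g_{\mathbb C}\) its Lie algebra, \(\mathfrak g_{\mathbb R}\) its real elements (defined over \(\mathbb R\)), \(\check{\mathcal M}\) the \(G_{\mathbb C}\)-orbit of \(\mathcal M\). A nilpotent orbit is \(e^{zN}.F\) with \(F\in\check{\mathcal M}\), \(N\in\mathfrak g_{\mathbb R}\) nilpotent and \(N(F^p)\subseteq F^{p-1}\) for all \(p\). Deligne bigrading of a mixed Hodge structure \((F',W)\): unique \(V=\bigoplus I^{p,q}\) with \(F'^p=\bigoplus_{a\ge p}I^{a,b}\), \(W_k=\bigoplus_{a+b\le k}I^{a,b}\), \(\overline{I^{p,q}}\equiv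 I^{q,p}\bmod\bigoplus_{r<q,s<p}I^{r,s}\). The Hodge components \(X^{r,s}\) of \(X\in\mathfrak g_{\mathbb C}\) with respect to \((F',W)\) are its components in \(\mathfrak g^{r,s}_{\mathbb C}\) = elements mapping each \(I^{p,q}\) into \(I^{p+r,q+s}\) (\(\mathfrak g_{\mathbb C}=\bigoplus_{r+s\le0}\mathfrak g^{r,s}_{\mathbb C}\)). *)

theory Defs
  imports "HOL-Analysis.Analysis"
begin

text \<open>Model: V_Q = Q^n (after a choice of basis), V = C^n = complex^'n with the
standard rational structure; endomorphisms of V are n x n complex matrices
acting by (*v). All spans/subspaces/dimensions are complex-linear (vec.*).\<close>


definition cconj :: "(complex ^ ('n::finite)) \<Rightarrow> (complex ^ ('n::finite))" where
  "cconj v = (\<chi> i. cnj (v $ i))"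

definition rational_vec :: "(complex ^ ('n::finite)) \<Rightarrow> bool" where
  "rational_vec v \<longleftrightarrow> (\<forall>i. v $ i \<in> \<rat>)"

definition rational_subspace :: "(complex ^ ('n::finite)) set \<Rightarrow> bool" where
  "rational_subspace S \<longleftrightarrow> vec.subspace S \<and> S = vec.span {v \<in> S. rational_vec v}"

definition real_end :: "(complex ^ ('n::finite) ^ 'n) \<Rightarrow> bool" where
  "real_end X \<longleftrightarrow> (\<forall>i j. X $ i $ j \<in> \<real>)"

definition set_plus :: "(complex ^ ('n::finite)) set \<Rightarrow> (complex ^ ('n::finite)) set \<Rightarrow> (complex ^ ('n::finite)) set" where
  "set_plus A B = {a + b | a b. a \<in> A \<and> b \<in> B}"

fun mpow :: "(complex ^ ('n::finite) ^ 'n) \<Rightarrow> nat \<Rightarrow> (complex ^ ('n::finite) ^ 'n)" where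
  "mpow A 0 = mat 1"
| "mpow A (Suc k) = A ** mpow A k"

definition cscale :: "complex \<Rightarrow> (complex ^ ('n::finite) ^ 'n) \<Rightarrow> (complex ^ ('n::finite) ^ 'n)" where
  "cscale c A = (\<chi> i j. c * A $ i $ j)"

definition nilpotent_end :: "(complex ^ ('n::finite) ^ 'n) \<Rightarrow> bool" where
  "nilpotent_end N \<longleftrightarrow> (\<exists>k. mpow N k = 0)"

text \<open>Exponential of a nilpotent endomorphism (N^n = 0 on an n-dimensional space,
so the exponential series is this finite sum).\<close>
definition nexp :: "(complex ^ ('n::finite) ^ 'n) \<Rightarrow> (complex ^ ('n::finite) ^ 'n)" where
  "nexp N = (\<Sum>k\<le>CARD('n). cscale (1 / of_nat (fact k)) (mpow N k))"

text \<open>Filtrations are indexed by int.\<close>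
definition incr_filtration :: "(int \<Rightarrow> (complex ^ ('n::finite)) set) \<Rightarrow> bool" where
  "incr_filtration W \<longleftrightarrow> (\<forall>k. vec.subspace (W k) \<and> W k \<subseteq> W (k + 1))
     \<and> (\<exists>a. W a = {0}) \<and> (\<exists>b. W b = UNIV)"

definition decr_filtration :: "(int \<Rightarrow> (complex ^ ('n::finite)) set) \<Rightarrow> bool" where
  "decr_filtration F \<longleftrightarrow> (\<forall>p. vec.subspace (F p) \<and> F (p + 1) \<subseteq> F p)
     \<and> (\<exists>a. F a = UNIV) \<and> (\<exists>b. F b = {0})"

definition rational_incr_filtration :: "(int \<Rightarrow> (complex ^ ('n::finite)) set) \<Rightarrow> bool" where
  "rational_incr_filtration W \<longleftrightarrow> incr_filtration W \<and> (\<forall>k. rational_subspace (W k))"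

text \<open>A complex bilinear form on V; Q k is viewed as a form on Gr^W_k = W_k/W_{k-1}
by requiring that W_{k-1} lies in its radical (restricted to W_k).\<close>
definition bilinear_c :: "((complex ^ ('n::finite)) \<Rightarrow> (complex ^ ('n::finite)) \<Rightarrow> complex) \<Rightarrow> bool" where
  "bilinear_c B \<longleftrightarrow> (\<forall>u u' v. B (u + u') v = B u v + B u' v)
     \<and> (\<forall>u v v'. B u (v + v') = B u v + B u v')
     \<and> (\<forall>c u v. B (c *s u) v = c * B u v) \<and> (\<forall>c u v. B u (c *s v) = c * B u v)"

definition graded_forms :: "(int \<Rightarrow> (complex ^ ('n::finite)) set) \<Rightarrow> (int \<Rightarrow> (complex ^ ('n::finite)) \<Rightarrow> (complex ^ ('n::finite)) \<Rightarrow> complex) \<Rightarrow> bool" where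
  "graded_forms W Q \<longleftrightarrow> (\<forall>k.
      bilinear_c (Q k)
    \<and> (\<forall>u\<in>W (k - 1). \<forall>v\<in>W k. Q k u v = 0 \<and> Q k v u = 0)
    \<and> (\<forall>u\<in>W k. \<forall>v\<in>W k. Q k v u = (-1) ^ nat \<bar>k\<bar> * Q k u v)
    \<and> (\<forall>u\<in>W k. \<forall>v\<in>W k. rational_vec u \<longrightarrow> rational_vec v \<longrightarrow> Q k u v \<in> \<rat>)
    \<and> (\<forall>u\<in>W k. (\<forall>v\<in>W k. Q k u v = 0) \<longrightarrow> u \<in> W (k - 1)))"

text \<open>Hodge filtration induced on Gr^W_k, pulled back to W_k (it contains W_{k-1}).\<close>
definition grF :: "(int \<Rightarrow> (complex ^ ('n::finite)) set) \<Rightarrow> (int \<Rightarrow> (complex ^ ('n::finite)) set) \<Rightarrow> int \<Rightarrow> int \<Rightarrow> (complex ^ ('n::finite)) set" where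
  "grF F W k p = set_plus (F p \<inter> W k) (W (k - 1))"

text \<open>(F,W) is a mixed Hodge structure: F induces a pure Hodge structure of weight k on
each Gr^W_k, i.e. Gr_k = F^p Gr_k (+) conj(F^{k-p+1} Gr_k) for all p.\<close>
definition is_MHS :: "(int \<Rightarrow> (complex ^ ('n::finite)) set) \<Rightarrow> (int \<Rightarrow> (complex ^ ('n::finite)) set) \<Rightarrow> bool" where
  "is_MHS F W \<longleftrightarrow> decr_filtration F \<and> rational_incr_filtration W \<and>
     (\<forall>k p. set_plus (grF F W k p) (cconj ` grF F W k (k - p + 1)) = W k
          \<and> grF F W k p \<inter> cconj ` grF F W k (k - p + 1) = W (k - 1))"

text \<open>Graded polarization: on Gr_k, Q_k(F^p, F^{k-p+1}) = 0 and
i^{p-q} Q_k(v, conj v) > 0 for nonzero v in H^{p,q} = F^p \<inter> conj F^q, p+q=k.\<close>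
definition graded_polarized_MHS ::
  "(int \<Rightarrow> (complex ^ ('n::finite)) set) \<Rightarrow> (int \<Rightarrow> (complex ^ ('n::finite)) set) \<Rightarrow> (int \<Rightarrow> (complex ^ ('n::finite)) \<Rightarrow> (complex ^ ('n::finite)) \<Rightarrow> complex) \<Rightarrow> bool" where
  "graded_polarized_MHS F W Q \<longleftrightarrow> is_MHS F W \<and> graded_forms W Q \<and>
     (\<forall>k p. \<forall>u\<in>F p \<inter> W k. \<forall>v\<in>F (k - p + 1) \<inter> W k. Q k u v = 0) \<and>
     (\<forall>k p q v. p + q = k \<longrightarrow> v \<in> grF F W k p \<inter> cconj ` grF F W k q \<longrightarrow> v \<notin> W (k - 1) \<longrightarrow>
        \<i> powi (p - q) * Q k v (cconj v) \<in> \<real> \<and> Re (\<i> powi (p - q) * Q k v (cconj v)) > 0)"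

text \<open>The classifying space M (fixed Hodge numbers d p = dim F^p).\<close>
definition Mcal :: "(int \<Rightarrow> (complex ^ ('n::finite)) set) \<Rightarrow> (int \<Rightarrow> (complex ^ ('n::finite)) \<Rightarrow> (complex ^ ('n::finite)) \<Rightarrow> complex) \<Rightarrow> (int \<Rightarrow> nat)
     \<Rightarrow> (int \<Rightarrow> (complex ^ ('n::finite)) set) set" where
  "Mcal W Q d = {F. (\<forall>p. vec.dim (F p) = d p) \<and> graded_polarized_MHS F W Q}"

text \<open>G_C: automorphisms of V preserving W and acting on each Gr^W_k by automorphisms of Q_k.\<close>
definition GC :: "(int \<Rightarrow> (complex ^ ('n::finite)) set) \<Rightarrow> (int \<Rightarrow> (complex ^ ('n::finite)) \<Rightarrow> (complex ^ ('n::finite)) \<Rightarrow> complex) \<Rightarrow> (complex ^ ('n::finite) ^ 'n) set" where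
  "GC W Q = {g. invertible g \<and> (\<forall>k. (*v) g ` W k = W k) \<and>
     (\<forall>k. \<forall>u\<in>W k. \<forall>v\<in>W k. Q k (g *v u) (g *v v) = Q k u v)}"

text \<open>Its Lie algebra g_C and the real form g_R.\<close>
definition gC :: "(int \<Rightarrow> (complex ^ ('n::finite)) set) \<Rightarrow> (int \<Rightarrow> (complex ^ ('n::finite)) \<Rightarrow> (complex ^ ('n::finite)) \<Rightarrow> complex) \<Rightarrow> (complex ^ ('n::finite) ^ 'n) set" where
  "gC W Q = {X. (\<forall>k. (*v) X ` W k \<subseteq> W k) \<and>
     (\<forall>k. \<forall>u\<in>W k. \<forall>v\<in>W k. Q k (X *v u) v + Q k u (X *v v) = 0)}"

definition gR :: "(int \<Rightarrow> (complex ^ ('n::finite)) set) \<Rightarrow> (int \<Rightarrow> (complex ^ ('n::finite)) \<Rightarrow> (complex ^ ('n::finite)) \<Rightarrow> complex) \<Rightarrow> (complex ^ ('n::finite) ^ 'n) set" where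
  "gR W Q = {X \<in> gC W Q. real_end X}"

definition act :: "(complex ^ ('n::finite) ^ 'n) \<Rightarrow> (int \<Rightarrow> (complex ^ ('n::finite)) set) \<Rightarrow> (int \<Rightarrow> (complex ^ ('n::finite)) set)" (infixr "\<cdot>" 75) where
  "g \<cdot> F = (\<lambda>p. (*v) g ` F p)"

definition Mcheck :: "(int \<Rightarrow> (complex ^ ('n::finite)) set) \<Rightarrow> (int \<Rightarrow> (complex ^ ('n::finite)) \<Rightarrow> (complex ^ ('n::finite)) \<Rightarrow> complex) \<Rightarrow> (int \<Rightarrow> nat)
     \<Rightarrow> (int \<Rightarrow> (complex ^ ('n::finite)) set) set" where
  "Mcheck W Q d = {g \<cdot> F | g F. g \<in> GC W Q \<and> F \<in> Mcal W Q d}"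

definition nilpotent_orbit_data ::
  "(int \<Rightarrow> (complex ^ ('n::finite)) set) \<Rightarrow> (int \<Rightarrow> (complex ^ ('n::finite)) \<Rightarrow> (complex ^ ('n::finite)) \<Rightarrow> complex) \<Rightarrow> (int \<Rightarrow> nat)
    \<Rightarrow> (int \<Rightarrow> (complex ^ ('n::finite)) set) \<Rightarrow> (complex ^ ('n::finite) ^ 'n) \<Rightarrow> bool" where
  "nilpotent_orbit_data W Q d F N \<longleftrightarrow> F \<in> Mcheck W Q d \<and> N \<in> gR W Q \<and> nilpotent_end N
     \<and> (\<forall>p. (*v) N ` F p \<subseteq> F (p - 1))"

text \<open>Direct sum decomposition V = (+) I^{p,q} with finitely many nonzero summands.\<close>
definition bigr_support :: "(int \<Rightarrow> int \<Rightarrow> (complex ^ ('n::finite)) set) \<Rightarrow> (int \<times> int) set" where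
  "bigr_support I = {(p, q). I p q \<noteq> {0}}"

definition bigr_decomp :: "(int \<Rightarrow> int \<Rightarrow> (complex ^ ('n::finite)) set) \<Rightarrow> (complex ^ ('n::finite)) \<Rightarrow> (int \<times> int \<Rightarrow> (complex ^ ('n::finite))) \<Rightarrow> bool" where
  "bigr_decomp I v c \<longleftrightarrow> (\<forall>p q. c (p, q) \<in> I p q) \<and> (\<forall>pq. pq \<notin> bigr_support I \<longrightarrow> c pq = 0)
     \<and> v = (\<Sum>pq\<in>bigr_support I. c pq)"

definition is_direct_bigrading :: "(int \<Rightarrow> int \<Rightarrow> (complex ^ ('n::finite)) set) \<Rightarrow> bool" where
  "is_direct_bigrading I \<longleftrightarrow> (\<forall>p q. vec.subspace (I p q)) \<and> finite (bigr_support I)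
     \<and> (\<forall>v. \<exists>!c. bigr_decomp I v c)"

definition is_deligne_bigrading ::
  "(int \<Rightarrow> (complex ^ ('n::finite)) set) \<Rightarrow> (int \<Rightarrow> (complex ^ ('n::finite)) set) \<Rightarrow> (int \<Rightarrow> int \<Rightarrow> (complex ^ ('n::finite)) set) \<Rightarrow> bool" where
  "is_deligne_bigrading F W I \<longleftrightarrow> is_direct_bigrading I
     \<and> (\<forall>p. F p = vec.span (\<Union>{I a b | a b. a \<ge> p}))
     \<and> (\<forall>k. W k = vec.span (\<Union>{I a b | a b. a + b \<le> k}))
     \<and> (\<forall>p q. cconj ` I p q \<subseteq> set_plus (I q p) (vec.span (\<Union>{I r s | r s. r < q \<and> s < p})))"

definition deligne_I :: "(int \<Rightarrow> (complex ^ ('n::finite)) set) \<Rightarrow> (int \<Rightarrow> (complex ^ ('n::finite)) set) \<Rightarrow> int \<Rightarrow> int \<Rightarrow> (complex ^ ('n::finite)) set" where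
  "deligne_I F W = (THE I. is_deligne_bigrading F W I)"

text \<open>Projection onto I^{p,q} along the other summands.\<close>
definition bigr_proj :: "(int \<Rightarrow> int \<Rightarrow> (complex ^ ('n::finite)) set) \<Rightarrow> int \<Rightarrow> int \<Rightarrow> (complex ^ ('n::finite)) \<Rightarrow> (complex ^ ('n::finite))" where
  "bigr_proj I p q v = (THE c. bigr_decomp I v c) (p, q)"

text \<open>Hodge component X^{r,s} of X w.r.t. (F,W): X^{r,s} = sum_{p,q} pi_{p+r,q+s} X pi_{p,q},
as a linear map V \<rightarrow> V.\<close>
definition hodge_component ::
  "(int \<Rightarrow> (complex ^ ('n::finite)) set) \<Rightarrow> (int \<Rightarrow> (complex ^ ('n::finite)) set) \<Rightarrow> (complex ^ ('n::finite) ^ 'n) \<Rightarrow> int \<Rightarrow> int \<Rightarrow> (complex ^ ('n::finite)) \<Rightarrow> (complex ^ ('n::finite))" where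
  "hodge_component F W X r s v =
     (let I = deligne_I F W in
      \<Sum>pq\<in>bigr_support I. bigr_proj I (fst pq + r) (snd pq + s) (X *v bigr_proj I (fst pq) (snd pq) v))"

end

theory Submission
  imports Defs
begin

text \<open>
  Deligne's bigrading of a mixed Hodge structure \<open>(F, W)\<close> is given by the explicit formula
  \<open>I\<^sup>p\<^sup>,\<^sup>q = F\<^sup>p \<inter> W\<^sub>p\<^sub>+\<^sub>q \<inter> (conj F\<^sup>q \<inter> W\<^sub>p\<^sub>+\<^sub>q + \<Sum>\<^sub>j\<^sub>\<ge>\<^sub>1 conj F\<^sup>q\<^sup>-\<^sup>j \<inter> W\<^sub>p\<^sub>+\<^sub>q\<^sub>-\<^sub>j\<^sub>-\<^sub>1)\<close>;
  proving that these subspaces form a bigrading with Deligne's three properties, and that any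
  such bigrading is contained in (hence equal to) this one, evaluates \<^const>\<open>deligne_I\<close>.

  Now let \<open>F = e\<^sup>z\<^sup>N.F\<^sub>0\<close>. Since \<open>N\<close> commutes with \<open>e\<^sup>z\<^sup>N\<close>, still \<open>N F\<^sup>p \<subseteq> F\<^sup>p\<^sup>-\<^sup>1\<close>, and \<open>N\<close>
  preserves \<open>W\<close>, so \<open>N I\<^sup>p\<^sup>,\<^sup>q\<close> lies in the span of the \<open>I\<^sup>a\<^sup>,\<^sup>b\<close> with \<open>a \<ge> p - 1\<close> and
  \<open>a + b \<le> p + q\<close>: \<open>N\<^sup>r\<^sup>,\<^sup>s = 0\<close> unless \<open>r \<ge> -1\<close> and \<open>r + s \<le> 0\<close>. As \<open>N\<close> is real and
  \<open>I\<^sup>p\<^sup>,\<^sup>q \<equiv> conj I\<^sup>q\<^sup>,\<^sup>p\<close> modulo the \<open>I\<^sup>a\<^sup>,\<^sup>b\<close> with \<open>a < p\<close>, \<open>b < q\<close>, conjugating the same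
  statement for \<open>I\<^sup>q\<^sup>,\<^sup>p\<close> confines \<open>N I\<^sup>p\<^sup>,\<^sup>q\<close> to the \<open>I\<^sup>a\<^sup>,\<^sup>b\<close> with \<open>a \<le> p\<close> or
  \<open>(a, b) = (p + 1, q - 1)\<close>: so \<open>r \<le> 1\<close>, and \<open>r = 1\<close> forces \<open>s = -1\<close>. These are exactly the
  listed types.
\<close>

lemma cconj_nth [simp]: "cconj v $ i = cnj (v $ i)"
  by (simp add: cconj_def)

lemma cconj_add [simp]: "cconj (x + y) = cconj x + cconj y"
  and cconj_diff [simp]: "cconj (x - y) = cconj x - cconj y"
  and cconj_zero [simp]: "cconj 0 = 0"
  and cconj_cconj [simp]: "cconj (cconj x) = x"
  and cconj_scale [simp]: "cconj (c *s x) = cnj c *s cconj x"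
  by (simp_all add: vec_eq_iff)

lemma mem_cconj_image: "x \<in> cconj ` A \<longleftrightarrow> cconj x \<in> A"
  by (metis cconj_cconj image_iff)

lemma subspace_cconj_image: "vec.subspace S \<Longrightarrow> vec.subspace (cconj ` S)"
  unfolding vec.subspace_def by (auto simp: mem_cconj_image)

lemma cconj_span_subset: "cconj ` vec.span S \<subseteq> vec.span (cconj ` S)"
proof
  fix y assume "y \<in> cconj ` vec.span S"
  then obtain x where x: "x \<in> vec.span S" and y: "y = cconj x" by auto
  have "cconj x \<in> vec.span (cconj ` S)"
  proof (rule vec.span_induct[where P = "\<lambda>x. cconj x \<in> vec.span (cconj ` S)", OF x])
    show "vec.subspace {x. cconj x \<in> vec.span (cconj ` S)}"
      unfolding vec.subspace_def by (auto intro: vec.span_add vec.span_scale vec.span_zero)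
    show "\<And>x. x \<in> S \<Longrightarrow> cconj x \<in> vec.span (cconj ` S)"
      by (auto intro: vec.span_superset[THEN subsetD])
  qed
  then show "y \<in> vec.span (cconj ` S)" using y by simp
qed

lemma cnj_Rats: "x \<in> \<rat> \<Longrightarrow> cnj x = (x::complex)"
  by (erule Rats_cases') simp

lemma cconj_rational_vec: "rational_vec v \<Longrightarrow> cconj v = v"
  unfolding rational_vec_def by (simp add: vec_eq_iff cnj_Rats)

lemma cconj_image_rational_subspace:
  assumes "rational_subspace S"
  shows "cconj ` S = S"
proof -
  let ?R = "{v \<in> S. rational_vec v}"
  have S: "S = vec.span ?R" using assms unfolding rational_subspace_def by auto
  have "cconj ` ?R = ?R" using cconj_rational_vec by force
  then have sub: "cconj ` S \<subseteq> S" using cconj_span_subset[of ?R] S by simp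
  then have "S \<subseteq> cconj ` S" by (auto simp: mem_cconj_image)
  with sub show ?thesis by blast
qed

lemma cconj_real_end: "real_end N \<Longrightarrow> cconj (N *v x) = N *v cconj x"
  unfolding real_end_def by (simp add: vec_eq_iff matrix_vector_mult_def Reals_cnj_iff)

lemma set_plus_memI: "a \<in> A \<Longrightarrow> b \<in> B \<Longrightarrow> a + b \<in> set_plus A B"
  unfolding set_plus_def by blast

lemma zero_in_set_plus: "0 \<in> A \<Longrightarrow> 0 \<in> B \<Longrightarrow> 0 \<in> set_plus A B"
  using set_plus_memI[of 0 A 0 B] by simp

lemma set_plus_subset_left: "0 \<in> B \<Longrightarrow> A \<subseteq> set_plus A B"
  unfolding set_plus_def by force

lemma set_plus_subset_right: "0 \<in> A \<Longrightarrow> B \<subseteq> set_plus A B"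
  unfolding set_plus_def by force

lemma subspace_set_plus: "vec.subspace A \<Longrightarrow> vec.subspace B \<Longrightarrow> vec.subspace (set_plus A B)"
  unfolding set_plus_def by (rule vec.subspace_sums)

lemma set_plus_subset_span: "A \<subseteq> vec.span C \<Longrightarrow> B \<subseteq> vec.span C \<Longrightarrow> set_plus A B \<subseteq> vec.span C"
  unfolding set_plus_def by (auto intro: vec.span_add)

lemma finite_lex_max:
  fixes f g :: "'a \<Rightarrow> 'b::linorder"
  assumes "finite S" "S \<noteq> {}"
  obtains m where "m \<in> S" "\<And>j. j \<in> S \<Longrightarrow> f j \<le> f m" "\<And>j. j \<in> S \<Longrightarrow> f j = f m \<Longrightarrow> g j \<le> g m"
proof -
  define S' where "S' = {j \<in> S. f j = Max (f ` S)}"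
  have "Max (f ` S) \<in> f ` S" using assms by simp
  then have S': "finite S'" "S' \<noteq> {}" using assms(1) unfolding S'_def by auto
  then have "Max (g ` S') \<in> g ` S'" by simp
  then obtain m where m: "m \<in> S'" "g m = Max (g ` S')" by auto
  show ?thesis
  proof (rule that)
    show "m \<in> S" using m unfolding S'_def by simp
    show "f j \<le> f m" if "j \<in> S" for j using that m assms(1) unfolding S'_def by (simp add: Max_ge)
    show "g j \<le> g m" if "j \<in> S" "f j = f m" for j
      using that m S'(1) unfolding S'_def by (simp add: Max_ge)
  qed
qed

lemma Union_pred_mono:
  "(\<And>a b. P a b \<Longrightarrow> Q a b) \<Longrightarrow> \<Union>{I a b | a b. P a b} \<subseteq> \<Union>{I a b | a b. Q a b}"
  by blast

lemma span_Union_mono: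
  "(\<And>a b. P a b \<Longrightarrow> Q a b) \<Longrightarrow> vec.span (\<Union>{I a b | a b. P a b}) \<subseteq> vec.span (\<Union>{I a b | a b. Q a b})"
  by (intro vec.span_mono Union_pred_mono)

lemma mem_span_Union_subspaces:
  assumes "finite S" "\<And>i. i \<in> S \<Longrightarrow> vec.subspace (U i)" "v \<in> vec.span (\<Union>(U ` S))"
  shows "\<exists>c. (\<forall>i\<in>S. c i \<in> U i) \<and> v = sum c S"
  using assms
proof (induction S arbitrary: v rule: finite_induct)
  case empty
  then show ?case by simp
next
  case (insert j S)
  obtain x y where x: "x \<in> vec.span (U j)" and y: "y \<in> vec.span (\<Union>(U ` S))" and v: "v = x + y"
    using insert.prems(2) vec.span_Un[of "U j" "\<Union>(U ` S)"] by auto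
  have "x \<in> U j" using x insert.prems(1) by (metis insertI1 vec.span_eq_iff)
  obtain c where c: "\<forall>i\<in>S. c i \<in> U i" "y = sum c S"
    using insert.IH[OF _ y] insert.prems(1) by blast
  have "sum (c(j := x)) S = sum c S" using insert.hyps(2) by (intro sum.cong) auto
  then have "sum (c(j := x)) (insert j S) = x + sum c S" using insert.hyps by simp
  then show ?case using \<open>x \<in> U j\<close> v c insert.hyps by (intro exI[of _ "c(j := x)"]) auto
qed

section \<open>Direct bigradings\<close>

context
  fixes I :: "int \<Rightarrow> int \<Rightarrow> (complex ^ 'n::finite) set"
  assumes direct: "is_direct_bigrading I"
begin

lemma subspace_bigr: "vec.subspace (I p q)"
  using direct unfolding is_direct_bigrading_def by auto

lemma zero_in_bigr: "0 \<in> I p q"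
  using subspace_bigr vec.subspace_0 by blast

lemma finite_bigr_support: "finite (bigr_support I)"
  using direct unfolding is_direct_bigrading_def by auto

lemma bigr_proj_eqI: "bigr_decomp I v c \<Longrightarrow> bigr_proj I p q v = c (p, q)"
  using direct unfolding is_direct_bigrading_def bigr_proj_def by (metis the1_equality)

lemma bigr_decomp_proj: "bigr_decomp I v (\<lambda>i. bigr_proj I (fst i) (snd i) v)"
proof -
  obtain c where c: "bigr_decomp I v c" using direct unfolding is_direct_bigrading_def by blast
  then have "(\<lambda>i. bigr_proj I (fst i) (snd i) v) = c" using bigr_proj_eqI by auto
  with c show ?thesis by simp
qed

lemma bigr_proj_in: "bigr_proj I p q v \<in> I p q"
  using bigr_decomp_proj[of v] unfolding bigr_decomp_def by auto

lemma bigr_proj_outside: "(p, q) \<notin> bigr_support I \<Longrightarrow> bigr_proj I p q v = 0"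
  using bigr_decomp_proj[of v] unfolding bigr_decomp_def by auto

lemma sum_bigr_proj: "(\<Sum>i\<in>bigr_support I. bigr_proj I (fst i) (snd i) v) = v"
  using bigr_decomp_proj[of v] unfolding bigr_decomp_def by auto

lemma bigr_proj_add: "bigr_proj I p q (x + y) = bigr_proj I p q x + bigr_proj I p q y"
proof -
  have "bigr_decomp I (x + y) (\<lambda>i. bigr_proj I (fst i) (snd i) x + bigr_proj I (fst i) (snd i) y)"
    unfolding bigr_decomp_def
    using sum_bigr_proj[of x] sum_bigr_proj[of y] bigr_proj_outside
    by (auto simp: bigr_proj_in subspace_bigr vec.subspace_add sum.distrib)
  then show ?thesis by (simp add: bigr_proj_eqI)
qed

lemma bigr_proj_scale: "bigr_proj I p q (a *s x) = a *s bigr_proj I p q x"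
proof -
  have "bigr_decomp I (a *s x) (\<lambda>i. a *s bigr_proj I (fst i) (snd i) x)"
    unfolding bigr_decomp_def
    using bigr_proj_outside
    by (auto simp: bigr_proj_in subspace_bigr vec.subspace_scale)
       (metis sum_bigr_proj vec.scale_sum_right)
  then show ?thesis by (simp add: bigr_proj_eqI)
qed

lemma bigr_proj_of_mem: "x \<in> I a b \<Longrightarrow> bigr_proj I p q x = (if (p, q) = (a, b) then x else 0)"
proof -
  assume x: "x \<in> I a b"
  have "bigr_decomp I x (\<lambda>i. if i = (a, b) then x else 0)"
    unfolding bigr_decomp_def
    using x zero_in_bigr finite_bigr_support unfolding bigr_support_def by (auto simp: sum.delta')
  then show ?thesis by (simp add: bigr_proj_eqI)
qed

lemma bigr_proj_zero: "bigr_proj I p q 0 = 0"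
  using bigr_proj_of_mem[OF zero_in_bigr, of p q p q] by simp

lemma bigr_proj_span_eq_0:
  assumes "v \<in> vec.span (\<Union>{I a b | a b. P a b})" "\<not> P p q"
  shows "bigr_proj I p q v = 0"
proof -
  have "\<forall>p q. \<not> P p q \<longrightarrow> bigr_proj I p q v = 0"
  proof (rule vec.span_induct[where P = "\<lambda>v. \<forall>p q. \<not> P p q \<longrightarrow> bigr_proj I p q v = 0", OF assms(1)])
    show "vec.subspace {v. \<forall>p q. \<not> P p q \<longrightarrow> bigr_proj I p q v = 0}"
      unfolding vec.subspace_def by (auto simp: bigr_proj_add bigr_proj_scale bigr_proj_zero)
    show "\<And>x. x \<in> \<Union>{I a b | a b. P a b} \<Longrightarrow> \<forall>p q. \<not> P p q \<longrightarrow> bigr_proj I p q x = 0"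
      using bigr_proj_of_mem by fastforce
  qed
  with assms(2) show ?thesis by blast
qed

lemma bigr_split:
  obtains v1 v2 where "v = v1 + v2" "v1 \<in> vec.span (\<Union>{I a b | a b. P a b})"
    "v2 \<in> vec.span (\<Union>{I a b | a b. \<not> P a b \<and> bigr_proj I a b v \<noteq> 0})"
proof -
  let ?S = "bigr_support I" and ?c = "\<lambda>i. bigr_proj I (fst i) (snd i) v"
  let ?P = "{i. P (fst i) (snd i)}"
  have "v = sum ?c (?S \<inter> ?P) + sum ?c (?S - ?P)"
    using sum.Int_Diff[OF finite_bigr_support, of ?c ?P] sum_bigr_proj[of v] by simp
  moreover have "sum ?c (?S \<inter> ?P) \<in> vec.span (\<Union>{I a b | a b. P a b})"
    by (intro vec.span_sum vec.span_superset[THEN subsetD]) (use bigr_proj_in in fastforce)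
  moreover have "sum ?c (?S - ?P) \<in> vec.span (\<Union>{I a b | a b. \<not> P a b \<and> bigr_proj I a b v \<noteq> 0})"
  proof (intro vec.span_sum)
    fix i assume "i \<in> ?S - ?P"
    then show "?c i \<in> vec.span (\<Union>{I a b | a b. \<not> P a b \<and> bigr_proj I a b v \<noteq> 0})"
      using bigr_proj_in[of "fst i" "snd i" v]
      by (cases "?c i = 0") (auto simp: vec.span_zero intro!: vec.span_superset[THEN subsetD])
  qed
  ultimately show ?thesis using that by blast
qed

end

lemma direct_bigrading_eqI:
  assumes I: "is_direct_bigrading I" and J: "is_direct_bigrading J"
    and sub: "\<And>p q. I p q \<subseteq> J p q"
  shows "I = J"
proof (intro ext equalityI)
  fix p q
  show "I p q \<subseteq> J p q" by (rule sub)
  show "J p q \<subseteq> I p q"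
  proof
    fix v assume v: "v \<in> J p q"
    let ?c = "\<lambda>i. bigr_proj I (fst i) (snd i) v"
    have supp: "bigr_support I \<subseteq> bigr_support J"
      using sub zero_in_bigr[OF I] unfolding bigr_support_def by blast
    have "bigr_decomp J v ?c"
      unfolding bigr_decomp_def
    proof (intro conjI allI impI)
      show "?c (a, b) \<in> J a b" for a b using bigr_proj_in[OF I, of a b v] sub[of a b] by auto
      show "?c i = 0" if "i \<notin> bigr_support J" for i
        using that supp bigr_proj_outside[OF I, of "fst i" "snd i"] by auto
      have "v = sum ?c (bigr_support I)" using sum_bigr_proj[OF I] by simp
      also have "\<dots> = sum ?c (bigr_support J)"
        using supp bigr_proj_outside[OF I] finite_bigr_support[OF J]
        by (intro sum.mono_neutral_left) auto
      finally show "v = sum ?c (bigr_support J)" .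
    qed
    then have "bigr_proj I p q v = bigr_proj J p q v" using bigr_proj_eqI[OF J] by simp
    also have "\<dots> = v" using bigr_proj_of_mem[OF J v] by simp
    finally show "v \<in> I p q" using bigr_proj_in[OF I] by metis
  qed
qed

lemma deligne_bigrading_subset_F: "is_deligne_bigrading F W I \<Longrightarrow> I a b \<subseteq> F a"
  unfolding is_deligne_bigrading_def by (blast intro: vec.span_superset[THEN subsetD])

lemma deligne_bigrading_subset_W: "is_deligne_bigrading F W I \<Longrightarrow> I a b \<subseteq> W (a + b)"
  unfolding is_deligne_bigrading_def by (blast intro: vec.span_superset[THEN subsetD])

section \<open>Deligne's bigrading\<close>

text \<open>The last two axioms say that on \<open>Gr\<^sup>W\<^sub>k\<close> the subspaces induced by \<open>F\<^sup>p\<close> and by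
  \<open>conj F\<^sup>q\<close>, \<open>p + q = k + 1\<close>, are complementary; they are phrased with representatives in \<open>W\<^sub>k\<close>.\<close>

locale mixed_hodge =
  fixes F W :: "int \<Rightarrow> (complex ^ 'n::finite) set"
  assumes subspace_F: "vec.subspace (F p)"
    and F_succ_subset: "F (p + 1) \<subseteq> F p"
    and F_exhaustive: "\<exists>a. F a = UNIV"
    and F_separated: "\<exists>b. F b = {0}"
    and subspace_W: "vec.subspace (W k)"
    and W_subset_succ: "W k \<subseteq> W (k + 1)"
    and W_separated: "\<exists>a. W a = {0}"
    and W_exhaustive: "\<exists>b. W b = UNIV"
    and cconj_W: "cconj ` W k = W k"
    and hodge_sum: "p + q = k + 1 \<Longrightarrow> x \<in> W k \<Longrightarrow>
      \<exists>f g w. f \<in> F p \<inter> W k \<and> g \<in> cconj ` F q \<inter> W k \<and> w \<in> W (k - 1) \<and> x = f + g + w"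
    and hodge_opposed: "p + q = k + 1 \<Longrightarrow> x \<in> F p \<inter> W k \<Longrightarrow> y \<in> cconj ` F q \<inter> W k \<Longrightarrow>
      x - y \<in> W (k - 1) \<Longrightarrow> x \<in> W (k - 1)"
begin

definition Fbar :: "int \<Rightarrow> (complex ^ 'n) set" where
  "Fbar q = cconj ` F q"

lemma mem_Fbar: "x \<in> Fbar q \<longleftrightarrow> cconj x \<in> F q"
  unfolding Fbar_def by (rule mem_cconj_image)

lemma subspace_Fbar: "vec.subspace (Fbar q)"
  unfolding Fbar_def by (rule subspace_cconj_image[OF subspace_F])

lemma cconj_mem_W: "cconj x \<in> W k \<longleftrightarrow> x \<in> W k"
  using cconj_W[of k] by (metis mem_cconj_image)

lemma zero_in_F: "0 \<in> F p" and zero_in_Fbar: "0 \<in> Fbar p" and zero_in_W: "0 \<in> W k"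
  using subspace_F subspace_Fbar subspace_W vec.subspace_0 by blast+

lemma F_antimono:
  assumes "p \<le> p'"
  shows "F p' \<subseteq> F p"
  using assms
proof (induction p' rule: int_ge_induct)
  case (step i)
  then show ?case using F_succ_subset[of i] by blast
qed simp

lemma W_mono:
  assumes "k \<le> k'"
  shows "W k \<subseteq> W k'"
  using assms
proof (induction k' rule: int_ge_induct)
  case (step i)
  then show ?case using W_subset_succ[of i] by blast
qed simp

lemma Fbar_antimono: "p \<le> p' \<Longrightarrow> Fbar p' \<subseteq> Fbar p"
  unfolding Fbar_def using F_antimono by blast

lemma W_eq_0_below: "\<exists>a. \<forall>k\<le>a. W k = {0}"
  using W_separated W_mono zero_in_W by blast

lemma W_eq_UNIV_above: "\<exists>b. \<forall>k\<ge>b. W k = UNIV"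
  using W_exhaustive W_mono by blast

lemma F_eq_UNIV_below: "\<exists>a. \<forall>p\<le>a. F p = UNIV"
  using F_exhaustive F_antimono by blast

lemma F_eq_0_above: "\<exists>b. \<forall>p\<ge>b. F p = {0}"
  using F_separated F_antimono zero_in_F by blast

lemma W_induct [case_names trivial step]:
  assumes trivial: "\<And>k. W k = {0} \<Longrightarrow> P k" and step: "\<And>k. P (k - 1) \<Longrightarrow> P k"
  shows "P k"
proof -
  obtain a where a: "\<forall>k\<le>a. W k = {0}" using W_eq_0_below by blast
  show ?thesis
  proof (induction k rule: int_induct[of _ a])
    case base
    then show ?case using a trivial by simp
  next
    case (step1 i)
    then show ?case using step[of "i + 1"] by simp
  next
    case (step2 i)
    then show ?case using a trivial by simp
  qed
qed

lemma F_induct [case_names trivial step]: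
  assumes trivial: "\<And>p. F p = {0} \<Longrightarrow> P p" and step: "\<And>p. P (p + 1) \<Longrightarrow> P p"
  shows "P p"
proof -
  obtain b where b: "\<forall>p\<ge>b. F p = {0}" using F_eq_0_above by blast
  show ?thesis
  proof (induction p rule: int_induct[of _ b])
    case base
    then show ?case using b trivial by simp
  next
    case (step1 i)
    then show ?case using b trivial by simp
  next
    case (step2 i)
    then show ?case using step[of "i - 1"] by simp
  qed
qed

definition Rtail :: "int \<Rightarrow> int \<Rightarrow> int \<Rightarrow> (complex ^ 'n) set" where
  "Rtail p q m = vec.span (\<Union>{Fbar (q - j) \<inter> W (p + q - j - 1) | j. m \<le> j})"

abbreviation R :: "int \<Rightarrow> int \<Rightarrow> (complex ^ 'n) set" where
  "R p q \<equiv> Rtail p q 1"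

definition Ipq :: "int \<Rightarrow> int \<Rightarrow> (complex ^ 'n) set" where
  "Ipq p q = F p \<inter> W (p + q) \<inter> set_plus (Fbar q \<inter> W (p + q)) (R p q)"

lemma subspace_Rtail: "vec.subspace (Rtail p q m)"
  unfolding Rtail_def by (rule vec.subspace_span)

lemma zero_in_Rtail: "0 \<in> Rtail p q m"
  using subspace_Rtail vec.subspace_0 by blast

lemma Rtail_superset: "m \<le> j \<Longrightarrow> Fbar (q - j) \<inter> W (p + q - j - 1) \<subseteq> Rtail p q m"
  unfolding Rtail_def by (rule subset_trans[OF _ vec.span_superset]) blast

lemma Rtail_subset_W: "Rtail p q m \<subseteq> W (p + q - m - 1)"
  unfolding Rtail_def
proof (rule vec.span_minimal[OF Union_least subspace_W])
  fix X assume "X \<in> {Fbar (q - j) \<inter> W (p + q - j - 1) | j. m \<le> j}"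
  then obtain j where "m \<le> j" "X = Fbar (q - j) \<inter> W (p + q - j - 1)" by blast
  then show "X \<subseteq> W (p + q - m - 1)" using W_mono[of "p + q - j - 1" "p + q - m - 1"] by auto
qed

lemma Rtail_split: "Rtail p q m \<subseteq> set_plus (Fbar (q - m) \<inter> W (p + q - m - 1)) (Rtail p q (m + 1))"
proof -
  let ?A = "Fbar (q - m) \<inter> W (p + q - m - 1)"
  let ?B = "\<Union>{Fbar (q - j) \<inter> W (p + q - j - 1) | j. m + 1 \<le> j}"
  have "\<Union>{Fbar (q - j) \<inter> W (p + q - j - 1) | j. m \<le> j} \<subseteq> ?A \<union> ?B"
  proof
    fix x assume "x \<in> \<Union>{Fbar (q - j) \<inter> W (p + q - j - 1) | j. m \<le> j}"
    then obtain j where j: "m \<le> j" "x \<in> Fbar (q - j) \<inter> W (p + q - j - 1)" by auto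
    show "x \<in> ?A \<union> ?B"
    proof (cases "j = m")
      case False
      with j have "m + 1 \<le> j" by simp
      with j show ?thesis by blast
    qed (use j in simp)
  qed
  then have "Rtail p q m \<subseteq> vec.span (?A \<union> ?B)" unfolding Rtail_def by (rule vec.span_mono)
  also have "\<dots> = set_plus (vec.span ?A) (vec.span ?B)"
    unfolding set_plus_def by (rule vec.span_Un)
  also have "vec.span ?A = ?A"
    by (simp add: vec.subspace_inter subspace_Fbar subspace_W)
  finally show ?thesis unfolding Rtail_def .
qed

lemma Ipq_subset_F: "Ipq p q \<subseteq> F p"
  and Ipq_subset_W: "Ipq p q \<subseteq> W (p + q)"
  unfolding Ipq_def by blast+

lemma subspace_Ipq: "vec.subspace (Ipq p q)"
  unfolding Ipq_def
  by (intro vec.subspace_inter subspace_set_plus subspace_F subspace_W subspace_Fbar subspace_Rtail)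

lemma zero_in_Ipq: "0 \<in> Ipq p q"
  using subspace_Ipq vec.subspace_0 by blast

lemma Ipq_memI:
  "x \<in> F p \<Longrightarrow> x \<in> W (p + q) \<Longrightarrow> u \<in> Fbar q \<Longrightarrow> u \<in> W (p + q) \<Longrightarrow> r \<in> R p q \<Longrightarrow> x = u + r
   \<Longrightarrow> x \<in> Ipq p q"
  unfolding Ipq_def set_plus_def by blast

lemma Ipq_memE:
  assumes "x \<in> Ipq p q"
  obtains u r where "x \<in> F p" "x \<in> W (p + q)" "u \<in> Fbar q" "u \<in> W (p + q)" "r \<in> R p q" "x = u + r"
  using assms unfolding Ipq_def set_plus_def by blast

lemma Fbar_Int_W_subset:
  assumes "l < p + q"
  shows "Fbar (l + 1 - p) \<inter> W l \<subseteq> (Fbar q \<inter> W (p + q)) \<union> R p q"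
proof (cases "l = p + q - 1")
  case True
  then show ?thesis using W_mono[of l "p + q"] by auto
next
  case False
  have "Fbar (l + 1 - p) \<inter> W l = Fbar (q - (p + q - 1 - l)) \<inter> W (p + q - (p + q - 1 - l) - 1)"
    by (simp add: algebra_simps)
  then show ?thesis using Rtail_superset[of 1 "p + q - 1 - l" q p] False assms by auto
qed

lemma W_pred_decomp:
  assumes k: "p + q = k" and x: "x \<in> W (k - 1)"
  shows "x \<in> set_plus (set_plus (F p \<inter> W (k - 1)) (Fbar q \<inter> W k)) (R p q)"
proof -
  define S where "S = set_plus (set_plus (F p \<inter> W (k - 1)) (Fbar q \<inter> W k)) (R p q)"
  have S: "vec.subspace S"
    unfolding S_def
    by (intro subspace_set_plus vec.subspace_inter subspace_F subspace_W subspace_Fbar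
        subspace_Rtail)
  have zeros: "0 \<in> F p \<inter> W (k - 1)" "0 \<in> Fbar q \<inter> W k" "0 \<in> R p q"
    by (simp_all add: zero_in_F zero_in_Fbar zero_in_W zero_in_Rtail)
  have FS: "F p \<inter> W (k - 1) \<subseteq> S"
    unfolding S_def by (intro subset_trans[OF set_plus_subset_left set_plus_subset_left] zeros)
  have FbarS: "Fbar q \<inter> W k \<subseteq> S"
    unfolding S_def by (intro subset_trans[OF set_plus_subset_right set_plus_subset_left] zeros)
  have RS: "R p q \<subseteq> S"
    unfolding S_def by (intro set_plus_subset_right zero_in_set_plus zeros)
  have "W l \<subseteq> S" if "l \<le> k - 1" for l
    using that
  proof (induction l rule: W_induct)
    case (trivial l)
    then show ?case using vec.subspace_0[OF S] by simp
  next
    case (step l)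
    show ?case
    proof
      fix y assume y: "y \<in> W l"
      obtain f g w where f: "f \<in> F p \<inter> W l" and g: "g \<in> Fbar (l + 1 - p) \<inter> W l"
        and w: "w \<in> W (l - 1)" and y_eq: "y = f + g + w"
        using hodge_sum[of p "l + 1 - p" l y] y unfolding Fbar_def by auto
      have "f \<in> S" using f FS W_mono[of l "k - 1"] step.prems by blast
      moreover have "g \<in> S" using g Fbar_Int_W_subset[of l p q] FbarS RS k step.prems by auto
      moreover have "w \<in> S" using w step.IH step.prems by auto
      ultimately show "y \<in> S" using y_eq S by (metis vec.subspace_add)
    qed
  qed
  then show ?thesis using x unfolding S_def by blast
qed

text \<open>Walking down the weight filtration, \<open>v = s + r\<close> with \<open>s \<in> conj F\<^sup>l\<^sup>+\<^sup>1\<^sup>-\<^sup>p \<inter> W\<^sub>l\<close> and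
  \<open>r \<in> W\<^sub>l\<^sub>-\<^sub>1\<close>; as \<open>v \<in> F\<^sup>p\<close>, opposedness on \<open>Gr\<^sup>W\<^sub>l\<close> pushes \<open>v\<close> into \<open>W\<^sub>l\<^sub>-\<^sub>1\<close>.\<close>

lemma Ipq_lower_weight_descent:
  assumes v: "v \<in> Ipq p q" and vW: "v \<in> W (p + q - 1)" and l: "l \<le> p + q - 1"
  shows "v \<in> W l \<and> (\<exists>s r. s \<in> Fbar (l + 1 - p) \<inter> W l \<and> r \<in> Rtail p q (p + q - l) \<and> v = s + r)"
  using l
proof (induction l rule: int_le_induct)
  case base
  obtain u r where ur: "u \<in> Fbar q" "r \<in> R p q" "v = u + r" using v by (rule Ipq_memE)
  have "r \<in> W (p + q - 1)"
    using ur(2) Rtail_subset_W[of p q 1] W_mono[of "p + q - 1 - 1" "p + q - 1"] by auto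
  then have "u \<in> W (p + q - 1)"
    using vW ur(3) subspace_W by (metis add_diff_cancel_right' vec.subspace_diff)
  then show ?case using vW ur by auto
next
  case (step l)
  then obtain s r where s: "s \<in> Fbar (l + 1 - p)" "s \<in> W l" and r: "r \<in> Rtail p q (p + q - l)"
    and vl: "v \<in> W l" and v_eq: "v = s + r"
    by blast
  have rW: "r \<in> W (l - 1)" using r Rtail_subset_W by fastforce
  then have "v - s \<in> W (l - 1)" using v_eq by simp
  moreover have "v \<in> F p" using v Ipq_subset_F by blast
  ultimately have vW': "v \<in> W (l - 1)"
    using hodge_opposed[of p "l + 1 - p" l v s] s vl unfolding Fbar_def by auto
  have sW': "s \<in> W (l - 1)"
    using vW' rW v_eq subspace_W by (metis add_diff_cancel_right' vec.subspace_diff)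
  obtain w r' where w: "w \<in> Fbar (l - p) \<inter> W (l - 1)" and r': "r' \<in> Rtail p q (p + q - (l - 1))"
    and r_eq: "r = w + r'"
    using Rtail_split[of p q "p + q - l"] r unfolding set_plus_def by (auto simp: algebra_simps)
  have "s \<in> Fbar (l - p)" using s Fbar_antimono[of "l - p" "l + 1 - p"] by auto
  then have "s + w \<in> Fbar (l - 1 + 1 - p) \<inter> W (l - 1)"
    using w sW' subspace_Fbar subspace_W by (auto intro: vec.subspace_add)
  moreover have "v = (s + w) + r'" using v_eq r_eq by (simp add: algebra_simps)
  ultimately show ?case using vW' r' by blast
qed

lemma Ipq_Int_W_pred: "Ipq p q \<inter> W (p + q - 1) = {0}"
proof -
  obtain a where a: "\<forall>k\<le>a. W k = {0}" using W_eq_0_below by blast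
  have "v = 0" if "v \<in> Ipq p q" "v \<in> W (p + q - 1)" for v
    using Ipq_lower_weight_descent[OF that, of "min a (p + q - 1)"] a by auto
  then show ?thesis using zero_in_Ipq zero_in_W by blast
qed

lemma F_W_decomp:
  assumes x: "x \<in> F p \<inter> W k"
  obtains d x1 f where "d \<in> Ipq p (k - p)" "x1 \<in> F (p + 1) \<inter> W k" "f \<in> F p \<inter> W (k - 1)"
    "x = d + x1 + f"
proof -
  obtain x1 y1 w where x1: "x1 \<in> F (p + 1) \<inter> W k" and y1: "y1 \<in> cconj ` F (k - p) \<inter> W k"
    and w: "w \<in> W (k - 1)" and x_eq: "x = x1 + y1 + w"
    using hodge_sum[of "p + 1" "k - p" k x] x by auto
  obtain f g r where f: "f \<in> F p \<inter> W (k - 1)" and g: "g \<in> Fbar (k - p) \<inter> W k"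
    and r: "r \<in> R p (k - p)" and w_eq: "w = f + g + r"
    using W_pred_decomp[of p "k - p" k w] w unfolding set_plus_def by auto
  have x1F: "x1 \<in> F p" using x1 F_antimono[of p "p + 1"] by auto
  have fW: "f \<in> W k" using f W_mono[of "k - 1" k] by auto
  have "x - x1 - f \<in> Ipq p (k - p)"
  proof (rule Ipq_memI)
    show "x - x1 - f \<in> F p" using x x1F f subspace_F by (meson IntD1 vec.subspace_diff)
    show "x - x1 - f \<in> W (p + (k - p))" using x x1 fW subspace_W by (simp add: vec.subspace_diff)
    show "y1 + g \<in> Fbar (k - p)"
      using y1 g subspace_Fbar vec.subspace_add unfolding Fbar_def by blast
    show "y1 + g \<in> W (p + (k - p))" using y1 g subspace_W by (simp add: vec.subspace_add)
    show "x - x1 - f = y1 + g + r" using x_eq w_eq by (simp add: algebra_simps)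
  qed (rule r)
  moreover have "x = (x - x1 - f) + x1 + f" by simp
  ultimately show thesis using that x1 f by blast
qed

definition Ispan :: "int \<Rightarrow> int \<Rightarrow> (complex ^ 'n) set" where
  "Ispan p k = vec.span (\<Union>{Ipq a b | a b. p \<le> a \<and> a + b \<le> k})"

lemma Ispan_mono: "p' \<le> p \<Longrightarrow> k \<le> k' \<Longrightarrow> Ispan p k \<subseteq> Ispan p' k'"
  unfolding Ispan_def by (rule span_Union_mono) auto

lemma Ipq_subset_Ispan: "p \<le> a \<Longrightarrow> a + b \<le> k \<Longrightarrow> Ipq a b \<subseteq> Ispan p k"
  unfolding Ispan_def by (rule subset_trans[OF _ vec.span_superset]) blast

lemma F_Int_W_subset_Ispan: "F p \<inter> W k \<subseteq> Ispan p k"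
proof (induction k arbitrary: p rule: W_induct)
  case (trivial k)
  then show ?case by (simp add: Ispan_def vec.span_zero zero_in_F)
next
  case (step k)
  note lower_weight = step.IH
  show ?case
  proof (induction p rule: F_induct)
    case (trivial p)
    then show ?case by (simp add: Ispan_def vec.span_zero zero_in_W)
  next
    case (step p)
    show ?case
    proof
      fix x assume "x \<in> F p \<inter> W k"
      then obtain d x1 f where d: "d \<in> Ipq p (k - p)" and x1: "x1 \<in> F (p + 1) \<inter> W k"
        and f: "f \<in> F p \<inter> W (k - 1)" and x: "x = d + x1 + f"
        by (rule F_W_decomp)
      have "d \<in> Ispan p k" using d Ipq_subset_Ispan[of p p "k - p" k] by auto
      moreover have "x1 \<in> Ispan p k" using x1 step.IH Ispan_mono[of p "p + 1" k k] by auto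
      moreover have "f \<in> Ispan p k" using f lower_weight Ispan_mono[of p p "k - 1" k] by auto
      ultimately show "x \<in> Ispan p k" unfolding x Ispan_def by (intro vec.span_add)
    qed
  qed
qed

lemma F_eq_span_Ipq: "F p = vec.span (\<Union>{Ipq a b | a b. a \<ge> p})"
proof
  obtain b where b: "\<forall>k\<ge>b. W k = UNIV" using W_eq_UNIV_above by blast
  have "F p \<subseteq> Ispan p b" using F_Int_W_subset_Ispan[of p b] b by auto
  also have "\<dots> \<subseteq> vec.span (\<Union>{Ipq a b | a b. a \<ge> p})"
    unfolding Ispan_def by (rule span_Union_mono) simp
  finally show "F p \<subseteq> vec.span (\<Union>{Ipq a b | a b. a \<ge> p})" .
  show "vec.span (\<Union>{Ipq a b | a b. a \<ge> p}) \<subseteq> F p"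
    by (rule vec.span_minimal[OF _ subspace_F]) (use Ipq_subset_F F_antimono in blast)
qed

lemma W_eq_span_Ipq: "W k = vec.span (\<Union>{Ipq a b | a b. a + b \<le> k})"
proof
  obtain a where a: "\<forall>p\<le>a. F p = UNIV" using F_eq_UNIV_below by blast
  have "W k \<subseteq> Ispan a k" using F_Int_W_subset_Ispan[of a k] a by auto
  also have "\<dots> \<subseteq> vec.span (\<Union>{Ipq a b | a b. a + b \<le> k})"
    unfolding Ispan_def by (rule span_Union_mono) simp
  finally show "W k \<subseteq> vec.span (\<Union>{Ipq a b | a b. a + b \<le> k})" .
  show "vec.span (\<Union>{Ipq a b | a b. a + b \<le> k}) \<subseteq> W k"
    by (rule vec.span_minimal[OF _ subspace_W]) (use Ipq_subset_W W_mono in blast)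
qed

lemma Ipq_subset_R:
  assumes "a < p" "b < q"
  shows "Ipq a b \<subseteq> R p q"
proof
  fix x assume "x \<in> Ipq a b"
  then obtain u r where u: "u \<in> Fbar b" "u \<in> W (a + b)" and r: "r \<in> R a b" and x: "x = u + r"
    by (rule Ipq_memE)
  have "u \<in> Fbar (q - (q - b)) \<inter> W (p + q - (q - b) - 1)"
    using u W_mono[of "a + b" "p + q - (q - b) - 1"] assms by auto
  then have "u \<in> R p q" using Rtail_superset[of 1 "q - b" q p] assms by auto
  moreover have "R a b \<subseteq> R p q"
    unfolding Rtail_def
  proof (rule vec.span_mono, rule subsetI)
    fix y assume "y \<in> \<Union>{Fbar (b - j) \<inter> W (a + b - j - 1) | j. 1 \<le> j}"
    then obtain j where j: "1 \<le> j" "y \<in> Fbar (b - j) \<inter> W (a + b - j - 1)" by auto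
    have "y \<in> Fbar (q - (q - b + j)) \<inter> W (p + q - (q - b + j) - 1)"
      using j W_mono[of "a + b - j - 1" "p + q - (q - b + j) - 1"] assms by auto
    moreover have "1 \<le> q - b + j" using j assms by simp
    ultimately show "y \<in> \<Union>{Fbar (q - j) \<inter> W (p + q - j - 1) | j. 1 \<le> j}" by blast
  qed
  ultimately show "x \<in> R p q" using r x subspace_Rtail vec.subspace_add by blast
qed

lemma Ipq_conj_part_eq_0:
  assumes x: "x \<in> Ipq a b" and conj_part: "x \<in> set_plus (Fbar (b + 1) \<inter> W (a + b)) (W (a + b - 1))"
  shows "x = 0"
proof -
  obtain g w where g: "g \<in> Fbar (b + 1) \<inter> W (a + b)" and w: "w \<in> W (a + b - 1)"
    and x_eq: "x = g + w"
    using conj_part unfolding set_plus_def by blast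
  have "x - g \<in> W (a + b - 1)" using w x_eq by simp
  moreover have "x \<in> F a \<inter> W (a + b)" using x Ipq_subset_F Ipq_subset_W by blast
  ultimately have "x \<in> W (a + b - 1)"
    using hodge_opposed[of a "b + 1" "a + b" x g] g unfolding Fbar_def by simp
  then show ?thesis using x Ipq_Int_W_pred by blast
qed

lemma Ipq_subset_conj_part:
  assumes "a' + b' < a + b \<or> (a' + b' = a + b \<and> a' < a)"
  shows "Ipq a' b' \<subseteq> set_plus (Fbar (b + 1) \<inter> W (a + b)) (W (a + b - 1))"
proof
  fix x assume x: "x \<in> Ipq a' b'"
  show "x \<in> set_plus (Fbar (b + 1) \<inter> W (a + b)) (W (a + b - 1))"
  proof (cases "a' + b' < a + b")
    case True
    then have "x \<in> W (a + b - 1)" using x Ipq_subset_W W_mono[of "a' + b'" "a + b - 1"] by auto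
    then show ?thesis
      using set_plus_subset_right[of "Fbar (b + 1) \<inter> W (a + b)"] zero_in_Fbar zero_in_W by auto
  next
    case False
    with assms have ab: "a' + b' = a + b" "a' < a" by auto
    obtain u r where u: "u \<in> Fbar b'" "u \<in> W (a' + b')" and r: "r \<in> R a' b'" and x_eq: "x = u + r"
      using x by (rule Ipq_memE)
    have "u \<in> Fbar (b + 1)" using u Fbar_antimono[of "b + 1" b'] ab by auto
    moreover have "r \<in> W (a + b - 1)"
      using r Rtail_subset_W[of a' b' 1] W_mono[of "a' + b' - 1 - 1" "a + b - 1"] ab by auto
    ultimately show ?thesis using u ab x_eq by (auto intro: set_plus_memI)
  qed
qed

text \<open>A vanishing sum of elements of the \<open>Ipq\<close> is peeled off at its summand of top weight and,
  among those, largest \<open>p\<close>: all other summands lie in \<open>conj F\<^sup>q\<^sup>+\<^sup>1 \<inter> W\<^sub>k + W\<^sub>k\<^sub>-\<^sub>1\<close>.\<close>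

lemma Ipq_independent:
  assumes "finite S" "\<And>i. i \<in> S \<Longrightarrow> c i \<in> Ipq (fst i) (snd i)" "sum c S = 0"
  shows "\<forall>i\<in>S. c i = 0"
  using assms
proof (induction S rule: finite_remove_induct)
  case empty
  then show ?case by simp
next
  case (remove A)
  obtain m where m: "m \<in> A" and max_weight: "\<And>j. j \<in> A \<Longrightarrow> fst j + snd j \<le> fst m + snd m"
    and max_p: "\<And>j. j \<in> A \<Longrightarrow> fst j + snd j = fst m + snd m \<Longrightarrow> fst j \<le> fst m"
    using finite_lex_max[OF remove.hyps(1,2), of "\<lambda>j. fst j + snd j" fst] by blast
  define T where "T = set_plus (Fbar (snd m + 1) \<inter> W (fst m + snd m)) (W (fst m + snd m - 1))"
  have T: "vec.subspace T"
    unfolding T_def by (intro subspace_set_plus vec.subspace_inter subspace_Fbar subspace_W)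
  have "c j \<in> T" if j: "j \<in> A - {m}" for j
  proof -
    have "fst j + snd j < fst m + snd m \<or> (fst j + snd j = fst m + snd m \<and> fst j < fst m)"
      using max_weight[of j] max_p[of j] j by (cases j, cases m) fastforce
    then show ?thesis using Ipq_subset_conj_part remove.prems(1)[of j] j unfolding T_def by blast
  qed
  then have "sum c (A - {m}) \<in> T" by (intro vec.subspace_sum[OF T])
  moreover have sum_A: "sum c A = c m + sum c (A - {m})" using sum.remove[OF remove.hyps(1) m] .
  then have "c m = - sum c (A - {m})" using remove.prems(2) by (simp add: eq_neg_iff_add_eq_0)
  ultimately have "c m \<in> T" using vec.subspace_neg[OF T] by simp
  then have cm: "c m = 0" using Ipq_conj_part_eq_0 remove.prems(1)[OF m] unfolding T_def by blast
  then have "\<forall>i\<in>A - {m}. c i = 0" using remove.IH[OF m] remove.prems sum_A by auto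
  with cm show ?case by blast
qed

lemma Ipq_nontrivial:
  assumes "Ipq p q \<noteq> {0}"
  shows "F p \<noteq> {0}" "F q \<noteq> {0}" "W (p + q) \<noteq> {0}"
proof -
  obtain v where v: "v \<in> Ipq p q" "v \<noteq> 0" using assms zero_in_Ipq by blast
  then show "F p \<noteq> {0}" "W (p + q) \<noteq> {0}" using Ipq_subset_F Ipq_subset_W by blast+
  show "F q \<noteq> {0}"
  proof
    assume Fq: "F q = {0}"
    obtain u r where u: "u \<in> Fbar q" and r: "r \<in> R p q" and v_eq: "v = u + r"
      using v(1) by (rule Ipq_memE)
    have "u = 0" using u Fq by (metis mem_Fbar singletonD cconj_cconj cconj_zero)
    then have "v \<in> W (p + q - 1)"
      using v_eq r Rtail_subset_W[of p q 1] W_mono[of "p + q - 1 - 1" "p + q - 1"] by auto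
    then show False using v Ipq_Int_W_pred by blast
  qed
qed

lemma finite_support_Ipq: "finite (bigr_support Ipq)"
proof -
  obtain a where a: "\<forall>k\<le>a. W k = {0}" using W_eq_0_below by blast
  obtain b where b: "\<forall>p\<ge>b. F p = {0}" using F_eq_0_above by blast
  have "(p, q) \<in> {a - b..b} \<times> {a - b..b}" if "(p, q) \<in> bigr_support Ipq" for p q
  proof -
    have "Ipq p q \<noteq> {0}" using that unfolding bigr_support_def by simp
    then have "p < b" "q < b" "a < p + q" using Ipq_nontrivial a b not_le by metis+
    then show ?thesis by simp
  qed
  then have "bigr_support Ipq \<subseteq> {a - b..b} \<times> {a - b..b}" by auto
  then show ?thesis by (rule finite_subset) simp
qed

lemma span_Ipq_support: "vec.span (\<Union>i\<in>bigr_support Ipq. Ipq (fst i) (snd i)) = UNIV"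
proof -
  let ?S = "vec.span (\<Union>i\<in>bigr_support Ipq. Ipq (fst i) (snd i))"
  have "Ipq a b \<subseteq> ?S" for a b
  proof (cases "(a, b) \<in> bigr_support Ipq")
    case True
    then show ?thesis by (force intro: vec.span_superset[THEN subsetD])
  next
    case False
    then show ?thesis unfolding bigr_support_def by (simp add: vec.span_zero)
  qed
  then have "W k \<subseteq> ?S" for k
    unfolding W_eq_span_Ipq[of k] by (intro vec.span_minimal vec.subspace_span) blast
  moreover obtain b where "\<forall>k\<ge>b. W k = UNIV" using W_eq_UNIV_above by blast
  ultimately show ?thesis by blast
qed

lemma direct_bigrading_Ipq: "is_direct_bigrading Ipq"
  unfolding is_direct_bigrading_def
proof (intro conjI allI ex_ex1I)
  show "vec.subspace (Ipq p q)" for p q by (rule subspace_Ipq)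
  show "finite (bigr_support Ipq)" by (rule finite_support_Ipq)
next
  fix v
  obtain c where c: "\<forall>i\<in>bigr_support Ipq. c i \<in> Ipq (fst i) (snd i)" "v = sum c (bigr_support Ipq)"
    using mem_span_Union_subspaces[OF finite_support_Ipq, of "\<lambda>i. Ipq (fst i) (snd i)" v]
      span_Ipq_support subspace_Ipq by auto
  let ?c = "\<lambda>i. if i \<in> bigr_support Ipq then c i else 0"
  have "bigr_decomp Ipq v ?c"
    unfolding bigr_decomp_def using c zero_in_Ipq by auto
  then show "\<exists>c. bigr_decomp Ipq v c" by blast
next
  fix v c1 c2 assume c1: "bigr_decomp Ipq v c1" and c2: "bigr_decomp Ipq v c2"
  let ?d = "\<lambda>i. c1 i - c2 i"
  have "?d i \<in> Ipq (fst i) (snd i)" for i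
    using c1 c2 subspace_Ipq unfolding bigr_decomp_def by (cases i) (auto intro: vec.subspace_diff)
  moreover have "sum ?d (bigr_support Ipq) = 0"
    using c1 c2 unfolding bigr_decomp_def by (simp add: sum_subtractf)
  ultimately have "\<forall>i\<in>bigr_support Ipq. ?d i = 0"
    using Ipq_independent[OF finite_support_Ipq, of ?d] by blast
  moreover have "c1 i = 0 \<and> c2 i = 0" if "i \<notin> bigr_support Ipq" for i
    using c1 c2 that unfolding bigr_decomp_def by (cases i) auto
  ultimately show "c1 = c2" by (metis eq_iff_diff_eq_0 ext)
qed

lemma cconj_R_subset: "cconj ` R p q \<subseteq> vec.span (\<Union>{Ipq a b | a b. b < p})"
proof -
  have "cconj ` R p q \<subseteq> vec.span (cconj ` \<Union>{Fbar (q - j) \<inter> W (p + q - j - 1) | j. 1 \<le> j})"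
    unfolding Rtail_def by (rule cconj_span_subset)
  also have "\<dots> \<subseteq> vec.span (\<Union>{Ipq a b | a b. b < p})"
  proof (rule vec.span_minimal[OF _ vec.subspace_span], rule subsetI)
    fix z assume "z \<in> cconj ` \<Union>{Fbar (q - j) \<inter> W (p + q - j - 1) | j. 1 \<le> j}"
    then obtain j where j: "1 \<le> j" "cconj z \<in> Fbar (q - j) \<inter> W (p + q - j - 1)"
      by (auto simp: mem_cconj_image)
    then have "z \<in> F (q - j) \<inter> W (p + q - j - 1)" by (auto simp: mem_Fbar cconj_mem_W)
    then have "z \<in> Ispan (q - j) (p + q - j - 1)" using F_Int_W_subset_Ispan by blast
    moreover have "Ispan (q - j) (p + q - j - 1) \<subseteq> vec.span (\<Union>{Ipq a b | a b. b < p})"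
      unfolding Ispan_def by (rule span_Union_mono) (use j in auto)
    ultimately show "z \<in> vec.span (\<Union>{Ipq a b | a b. b < p})" by blast
  qed
  finally show ?thesis .
qed

lemma bigr_proj_cconj_Ipq:
  assumes v: "v \<in> Ipq p q" and "a < q" and "bigr_proj Ipq a b (cconj v) \<noteq> 0"
  shows "b < p"
proof -
  obtain u r where u: "u \<in> Fbar q" "u \<in> W (p + q)" and r: "r \<in> R p q" and v_eq: "v = u + r"
    using v by (rule Ipq_memE)
  have "cconj u \<in> F q \<inter> W (p + q)" using u by (simp add: mem_Fbar cconj_mem_W)
  then have "cconj u \<in> Ispan q (p + q)" using F_Int_W_subset_Ispan by blast
  then have "bigr_proj Ipq a b (cconj u) = 0"
    using bigr_proj_span_eq_0[OF direct_bigrading_Ipq] \<open>a < q\<close> unfolding Ispan_def by auto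
  then have "bigr_proj Ipq a b (cconj r) \<noteq> 0"
    using assms(3) v_eq by (simp add: bigr_proj_add[OF direct_bigrading_Ipq])
  moreover have "cconj r \<in> vec.span (\<Union>{Ipq a b | a b. b < p})" using cconj_R_subset r by blast
  ultimately show "b < p"
    using bigr_proj_span_eq_0[OF direct_bigrading_Ipq, where P = "\<lambda>a b. b < p"] by blast
qed

lemma span_Ipq_below_subset: "vec.span (\<Union>{Ipq r s | r s. r < q \<and> s < p}) \<subseteq> W (p + q) \<inter> R q p"
proof (rule vec.span_minimal)
  have "Ipq r s \<subseteq> W (p + q)" if "r < q \<and> s < p" for r s
    using that Ipq_subset_W[of r s] W_mono[of "r + s" "p + q"] by auto
  then show "\<Union>{Ipq r s | r s. r < q \<and> s < p} \<subseteq> W (p + q) \<inter> R q p"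
    using Ipq_subset_R by blast
  show "vec.subspace (W (p + q) \<inter> R q p)" by (intro vec.subspace_inter subspace_W subspace_Rtail)
qed

lemma cconj_Ipq: "cconj ` Ipq p q \<subseteq> set_plus (Ipq q p) (vec.span (\<Union>{Ipq r s | r s. r < q \<and> s < p}))"
proof
  fix y assume "y \<in> cconj ` Ipq p q"
  then obtain v where v: "v \<in> Ipq p q" and y: "y = cconj v" by auto
  let ?L = "vec.span (\<Union>{Ipq r s | r s. r < q \<and> s < p})"
  obtain y1 y2 where y_eq: "y = y1 + y2" and y1: "y1 \<in> vec.span (\<Union>{Ipq a b | a b. q \<le> a})"
    and y2: "y2 \<in> vec.span (\<Union>{Ipq a b | a b. \<not> q \<le> a \<and> bigr_proj Ipq a b y \<noteq> 0})"
    by (rule bigr_split[OF direct_bigrading_Ipq])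
  have "\<Union>{Ipq a b | a b. \<not> q \<le> a \<and> bigr_proj Ipq a b y \<noteq> 0} \<subseteq> \<Union>{Ipq r s | r s. r < q \<and> s < p}"
    using bigr_proj_cconj_Ipq[OF v] y by (intro Union_pred_mono) (auto simp: not_le)
  then have y2_below: "y2 \<in> ?L" using y2 vec.span_mono by blast
  then have y2L: "y2 \<in> W (p + q) \<inter> R q p" using span_Ipq_below_subset by blast
  have "v \<in> F p" "v \<in> W (p + q)" using v Ipq_subset_F Ipq_subset_W by blast+
  then have yW: "y \<in> W (p + q)" and yFbar: "y \<in> Fbar p"
    using y by (simp_all add: cconj_mem_W mem_Fbar)
  have "y1 \<in> Ipq q p"
  proof (rule Ipq_memI)
    show "y1 \<in> F q" using y1 by (simp only: F_eq_span_Ipq[of q])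
    have "y1 = y - y2" using y_eq by simp
    then show "y1 \<in> W (q + p)" using y2L yW subspace_W by (simp add: add.commute vec.subspace_diff)
    show "y \<in> Fbar p" by (rule yFbar)
    show "y \<in> W (q + p)" using yW by (simp add: add.commute)
    show "- y2 \<in> R q p" using y2L subspace_Rtail vec.subspace_neg by blast
    show "y1 = y + - y2" using y_eq by simp
  qed
  then show "y \<in> set_plus (Ipq q p) ?L" using y_eq y2_below by (simp add: set_plus_memI)
qed

lemma deligne_bigrading_Ipq: "is_deligne_bigrading F W Ipq"
  unfolding is_deligne_bigrading_def
  by (intro conjI allI direct_bigrading_Ipq F_eq_span_Ipq W_eq_span_Ipq cconj_Ipq)

lemma deligne_bigrading_subset_Ipq:
  assumes I: "is_deligne_bigrading F W I"
  shows "I p q \<subseteq> Ipq p q"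
proof
  fix v assume v: "v \<in> I p q"
  obtain y e where y: "y \<in> I q p" and e: "e \<in> vec.span (\<Union>{I r s | r s. r < q \<and> s < p})"
    and cv: "cconj v = y + e"
    using I v unfolding is_deligne_bigrading_def set_plus_def by blast
  have "cconj ` \<Union>{I r s | r s. r < q \<and> s < p} \<subseteq> R p q"
  proof
    fix z assume "z \<in> cconj ` \<Union>{I r s | r s. r < q \<and> s < p}"
    then obtain r s where rs: "cconj z \<in> I r s" "r < q" "s < p" by (auto simp: mem_cconj_image)
    then have "cconj z \<in> F r \<inter> W (r + s)"
      using deligne_bigrading_subset_F[OF I] deligne_bigrading_subset_W[OF I] by blast
    then have "z \<in> Fbar r \<inter> W (r + s)" by (simp add: mem_Fbar cconj_mem_W)
    then have "z \<in> Fbar (q - (q - r)) \<inter> W (p + q - (q - r) - 1)"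
      using W_mono[of "r + s" "p + q - (q - r) - 1"] rs by auto
    then show "z \<in> R p q" using Rtail_superset[of 1 "q - r" q p] rs by auto
  qed
  then have "cconj ` vec.span (\<Union>{I r s | r s. r < q \<and> s < p}) \<subseteq> R p q"
    using cconj_span_subset vec.span_minimal[OF _ subspace_Rtail] by (meson subset_trans)
  then have "cconj e \<in> R p q" using e by blast
  moreover have "y \<in> F q" "y \<in> W (q + p)"
    using y deligne_bigrading_subset_F[OF I] deligne_bigrading_subset_W[OF I] by blast+
  then have "cconj y \<in> Fbar q" "cconj y \<in> W (p + q)"
    by (simp_all add: mem_Fbar cconj_mem_W add.commute)
  moreover have "v \<in> F p" "v \<in> W (p + q)"
    using v deligne_bigrading_subset_F[OF I] deligne_bigrading_subset_W[OF I] by blast+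
  moreover have "v = cconj y + cconj e" using arg_cong[OF cv, of cconj] by simp
  ultimately show "v \<in> Ipq p q" by (blast intro: Ipq_memI)
qed

lemma deligne_I_eq_Ipq: "deligne_I F W = Ipq"
  unfolding deligne_I_def
proof (rule the_equality)
  show "is_deligne_bigrading F W Ipq" by (rule deligne_bigrading_Ipq)
  fix I assume I: "is_deligne_bigrading F W I"
  then show "I = Ipq"
    using direct_bigrading_eqI[OF _ direct_bigrading_Ipq deligne_bigrading_subset_Ipq[OF I]]
    unfolding is_deligne_bigrading_def by blast
qed

section \<open>Hodge components of \<open>N\<close>\<close>

lemma cconj_Ispan:
  assumes "m - c = d"
  shows "cconj ` Ispan c m \<subseteq> vec.span (\<Union>{Ipq a b | a b. a < d \<or> (a = d \<and> b = c)})"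
proof -
  let ?T = "vec.span (\<Union>{Ipq a b | a b. a < d \<or> (a = d \<and> b = c)})"
  have "cconj ` Ispan c m \<subseteq> vec.span (cconj ` \<Union>{Ipq a b | a b. c \<le> a \<and> a + b \<le> m})"
    unfolding Ispan_def by (rule cconj_span_subset)
  also have "\<dots> \<subseteq> ?T"
  proof (rule vec.span_minimal[OF _ vec.subspace_span], rule subsetI)
    fix z assume "z \<in> cconj ` \<Union>{Ipq a b | a b. c \<le> a \<and> a + b \<le> m}"
    then obtain a b where ab: "cconj z \<in> Ipq a b" "c \<le> a" "a + b \<le> m"
      by (auto simp: mem_cconj_image)
    then have "z \<in> cconj ` Ipq a b" by (simp add: mem_cconj_image)
    then have "z \<in> set_plus (Ipq b a) (vec.span (\<Union>{Ipq r s | r s. r < b \<and> s < a}))"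
      using cconj_Ipq[of a b] by blast
    moreover have "b < d \<or> (b = d \<and> a = c)" using ab assms by auto
    then have "Ipq b a \<subseteq> \<Union>{Ipq a b | a b. a < d \<or> (a = d \<and> b = c)}" by blast
    then have "Ipq b a \<subseteq> ?T" using vec.span_superset by blast
    moreover have "vec.span (\<Union>{Ipq r s | r s. r < b \<and> s < a}) \<subseteq> ?T"
      by (rule span_Union_mono) (use ab assms in auto)
    ultimately show "z \<in> ?T" using set_plus_subset_span by blast
  qed
  finally show ?thesis .
qed

context
  fixes N :: "complex ^ 'n ^ 'n"
  assumes N_W: "\<And>k x. x \<in> W k \<Longrightarrow> N *v x \<in> W k"
    and N_F: "\<And>p x. x \<in> F p \<Longrightarrow> N *v x \<in> F (p - 1)"
    and N_real: "\<And>x. cconj (N *v x) = N *v cconj x"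
begin

lemma N_Ipq_lower: "x \<in> Ipq p q \<Longrightarrow> N *v x \<in> Ispan (p - 1) (p + q)"
  using Ipq_subset_F Ipq_subset_W N_F N_W F_Int_W_subset_Ispan by blast

lemma cconj_N_span:
  assumes "e \<in> vec.span (\<Union>{Ipq r s | r s. r < q \<and> s < p})"
  shows "cconj (N *v e) \<in> vec.span (\<Union>{Ipq a b | a b. a \<le> p})"
proof (rule vec.span_induct[where P = "\<lambda>e. cconj (N *v e) \<in> vec.span (\<Union>{Ipq a b | a b. a \<le> p})",
      OF assms])
  show "vec.subspace {e. cconj (N *v e) \<in> vec.span (\<Union>{Ipq a b | a b. a \<le> p})}"
    unfolding vec.subspace_def
    by (auto simp: matrix_vector_right_distrib vec.linear_scale[OF vec.linear_axioms]
        intro: vec.span_add vec.span_scale vec.span_zero)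
  fix z assume "z \<in> \<Union>{Ipq r s | r s. r < q \<and> s < p}"
  then obtain r s where z: "z \<in> Ipq r s" "s < p" by auto
  have "cconj (N *v z) \<in> vec.span (\<Union>{Ipq a b | a b. a < s + 1 \<or> (a = s + 1 \<and> b = r - 1)})"
    using N_Ipq_lower[OF z(1)] cconj_Ispan[of "r + s" "r - 1" "s + 1"] by auto
  also have "\<dots> \<subseteq> vec.span (\<Union>{Ipq a b | a b. a \<le> p})"
    by (rule span_Union_mono) (use z(2) in auto)
  finally show "cconj (N *v z) \<in> vec.span (\<Union>{Ipq a b | a b. a \<le> p})" .
qed

lemma N_Ipq_upper:
  assumes x: "x \<in> Ipq p q"
  shows "N *v x \<in> vec.span (\<Union>{Ipq a b | a b. a \<le> p \<or> (a = p + 1 \<and> b = q - 1)})"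
proof -
  let ?T = "vec.span (\<Union>{Ipq a b | a b. a \<le> p \<or> (a = p + 1 \<and> b = q - 1)})"
  obtain y e where y: "y \<in> Ipq q p" and e: "e \<in> vec.span (\<Union>{Ipq r s | r s. r < q \<and> s < p})"
    and cx: "cconj x = y + e"
    using cconj_Ipq[of p q] x unfolding set_plus_def by blast
  have "cconj (N *v y) \<in> vec.span (\<Union>{Ipq a b | a b. a < p + 1 \<or> (a = p + 1 \<and> b = q - 1)})"
    using N_Ipq_lower[OF y] cconj_Ispan[of "q + p" "q - 1" "p + 1"] by auto
  also have "\<dots> \<subseteq> ?T" by (rule span_Union_mono) auto
  finally have "cconj (N *v y) \<in> ?T" .
  moreover have "cconj (N *v e) \<in> ?T"
    using cconj_N_span[OF e]
      span_Union_mono[of "\<lambda>a b. a \<le> p" "\<lambda>a b. a \<le> p \<or> (a = p + 1 \<and> b = q - 1)" Ipq]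
    by blast
  moreover have "N *v x = cconj (N *v y) + cconj (N *v e)"
    using arg_cong[OF cx, of cconj]
    by (metis N_real cconj_add cconj_cconj matrix_vector_right_distrib)
  ultimately show ?thesis by (simp add: vec.span_add)
qed

lemma bigr_proj_N_Ipq:
  assumes x: "x \<in> Ipq p q" and rs: "\<not> (-1 \<le> r \<and> r \<le> 1 \<and> r + s \<le> 0 \<and> (r = 1 \<longrightarrow> s = -1))"
  shows "bigr_proj Ipq (p + r) (q + s) (N *v x) = 0"
proof (cases "-1 \<le> r \<and> r + s \<le> 0")
  case True
  with rs have "\<not> (p + r \<le> p \<or> (p + r = p + 1 \<and> q + s = q - 1))" by auto
  then show ?thesis using bigr_proj_span_eq_0[OF direct_bigrading_Ipq N_Ipq_upper[OF x]] by blast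
next
  case False
  then have "\<not> (p - 1 \<le> p + r \<and> p + r + (q + s) \<le> p + q)" by auto
  then show ?thesis
    using bigr_proj_span_eq_0[OF direct_bigrading_Ipq N_Ipq_lower[OF x, unfolded Ispan_def]]
    by blast
qed

lemma hodge_component_N_eq_0:
  assumes "\<not> (-1 \<le> r \<and> r \<le> 1 \<and> r + s \<le> 0 \<and> (r = 1 \<longrightarrow> s = -1))"
  shows "hodge_component F W N r s = (\<lambda>v. 0)"
  unfolding hodge_component_def deligne_I_eq_Ipq Let_def
  using bigr_proj_N_Ipq[OF bigr_proj_in[OF direct_bigrading_Ipq] assms] by simp

end

end

lemma is_MHS_cconj_W: "is_MHS F W \<Longrightarrow> cconj ` W k = W k"
  unfolding is_MHS_def rational_incr_filtration_def using cconj_image_rational_subspace by blast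

lemma is_MHS_hodge_sum:
  assumes MHS: "is_MHS F W" and pq: "p + q = k + 1" and x: "x \<in> W k"
  shows "\<exists>f g w. f \<in> F p \<inter> W k \<and> g \<in> cconj ` F q \<inter> W k \<and> w \<in> W (k - 1) \<and> x = f + g + w"
proof -
  have W_sub: "vec.subspace (W k)" for k
    using MHS unfolding is_MHS_def rational_incr_filtration_def incr_filtration_def by blast
  have W_cconj: "cconj x \<in> W k \<longleftrightarrow> x \<in> W k" for x k
    using is_MHS_cconj_W[OF MHS, of k] by (metis mem_cconj_image)
  have "set_plus (grF F W k p) (cconj ` grF F W k (k - p + 1)) = W k"
    using MHS unfolding is_MHS_def by blast
  moreover have "q = k - p + 1" using pq by simp
  ultimately have "x \<in> set_plus (grF F W k p) (cconj ` grF F W k q)" using x by simp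
  then obtain a b where a: "a \<in> grF F W k p" and b: "b \<in> cconj ` grF F W k q" and x_eq: "x = a + b"
    unfolding set_plus_def by blast
  obtain f w1 where f: "f \<in> F p \<inter> W k" and w1: "w1 \<in> W (k - 1)" and a_eq: "a = f + w1"
    using a unfolding grF_def set_plus_def by blast
  obtain g0 w2 where g0: "g0 \<in> F q \<inter> W k" and w2: "w2 \<in> W (k - 1)" and b_eq: "cconj b = g0 + w2"
    using b unfolding grF_def set_plus_def by (auto simp: mem_cconj_image)
  have "cconj g0 \<in> cconj ` F q \<inter> W k" using g0 W_cconj by auto
  moreover have "w1 + cconj w2 \<in> W (k - 1)" using w1 w2 W_cconj W_sub vec.subspace_add by blast
  moreover have "x = f + cconj g0 + (w1 + cconj w2)"
    using x_eq a_eq arg_cong[OF b_eq, of cconj] by (simp add: algebra_simps)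
  ultimately show ?thesis using f by blast
qed

lemma is_MHS_hodge_opposed:
  assumes MHS: "is_MHS F W" and pq: "p + q = k + 1"
    and x: "x \<in> F p \<inter> W k" and y: "y \<in> cconj ` F q \<inter> W k" and xy: "x - y \<in> W (k - 1)"
  shows "x \<in> W (k - 1)"
proof -
  have W_sub: "vec.subspace (W k)" for k
    using MHS unfolding is_MHS_def rational_incr_filtration_def incr_filtration_def by blast
  have W_cconj: "cconj x \<in> W k \<longleftrightarrow> x \<in> W k" for x k
    using is_MHS_cconj_W[OF MHS, of k] by (metis mem_cconj_image)
  have "x + 0 \<in> grF F W k p"
    unfolding grF_def by (rule set_plus_memI) (use x W_sub vec.subspace_0 in auto)
  then have xp: "x \<in> grF F W k p" by simp
  have "cconj y \<in> F q \<inter> W k" using y W_cconj by (auto simp: mem_cconj_image)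
  moreover have "cconj (x - y) \<in> W (k - 1)" using xy W_cconj by blast
  ultimately have "cconj y + cconj (x - y) \<in> grF F W k q"
    unfolding grF_def by (rule set_plus_memI)
  then have xq: "x \<in> cconj ` grF F W k q" by (simp add: mem_cconj_image)
  have "grF F W k p \<inter> cconj ` grF F W k (k - p + 1) = W (k - 1)"
    using MHS unfolding is_MHS_def by blast
  moreover have "q = k - p + 1" using pq by simp
  ultimately show ?thesis using xp xq by blast
qed

lemma mixed_hodge_if_is_MHS:
  assumes "is_MHS F W"
  shows "mixed_hodge F W"
proof -
  have "decr_filtration F" "incr_filtration W"
    using assms unfolding is_MHS_def rational_incr_filtration_def by auto
  then show ?thesis
    unfolding mixed_hodge_def decr_filtration_def incr_filtration_def
    using is_MHS_cconj_W[OF assms] is_MHS_hodge_sum[OF assms] is_MHS_hodge_opposed[OF assms]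
    by blast
qed

lemma matrix_add_rdistrib: "(B + C) ** A = B ** A + C ** A"
  by (vector matrix_matrix_mult_def sum.distrib[symmetric] field_simps)

lemma matrix_mul_cscale: "X ** cscale c A = cscale c (X ** A)"
  and cscale_matrix_mul: "cscale c A ** X = cscale c (A ** X)"
  unfolding cscale_def matrix_matrix_mult_def
  by (simp_all add: vec_eq_iff sum_distrib_left mult_ac)

lemma commute_mpow: "X ** A = A ** X \<Longrightarrow> X ** mpow A k = mpow A k ** X"
  by (induction k) (simp_all, metis matrix_mul_assoc)

lemma commute_sum: "(\<And>i. i \<in> S \<Longrightarrow> X ** f i = f i ** X) \<Longrightarrow> X ** sum f S = sum f S ** X"
  by (induction S rule: infinite_finite_induct)
    (simp_all add: matrix_add_ldistrib matrix_add_rdistrib)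

lemma nexp_commute: "N ** nexp (cscale z N) = nexp (cscale z N) ** N"
  unfolding nexp_def
  by (intro commute_sum) (simp add: matrix_mul_cscale cscale_matrix_mul commute_mpow)

lemma hodge_type_iff:
  fixes r s :: int
  shows "((r, s) = (-1, 1) \<or> (r, s) = (0, 0) \<or> (r, s) = (1, -1)
           \<or> (\<exists>k>0. (r, s) = (-1, 1 - k)) \<or> (\<exists>k>0. (r, s) = (0, -k)))
         \<longleftrightarrow> -1 \<le> r \<and> r \<le> 1 \<and> r + s \<le> 0 \<and> (r = 1 \<longrightarrow> s = -1)"
  by auto presburger+

lemma act_shift_if_commute:
  assumes "\<And>p. (*v) N ` F p \<subseteq> F (p - 1)" and "N ** E = E ** N" and "x \<in> (E \<cdot> F) p"
  shows "N *v x \<in> (E \<cdot> F) (p - 1)"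
proof -
  obtain x0 where x0: "x0 \<in> F p" "x = E *v x0" using assms(3) unfolding act_def by auto
  then have "N *v x = E *v (N *v x0)" using assms(2) by (simp add: matrix_vector_mul_assoc)
  moreover have "N *v x0 \<in> F (p - 1)" using assms(1) x0(1) by blast
  ultimately show ?thesis unfolding act_def by auto
qed

theorem lemma6p31:
  fixes W :: "int \<Rightarrow> (complex ^ 'n) set"
    and Q :: "int \<Rightarrow> complex ^ 'n \<Rightarrow> complex ^ 'n \<Rightarrow> complex"
    and d :: "int \<Rightarrow> nat"
    and F :: "int \<Rightarrow> (complex ^ 'n) set"
    and N :: "complex ^ 'n ^ 'n"
    and z :: complex
  assumes W: "rational_incr_filtration W"
    and Q: "graded_forms W Q"
    and orbit: "nilpotent_orbit_data W Q d F N"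
    and inM: "nexp (cscale z N) \<cdot> F \<in> Mcal W Q d"
  shows "\<forall>r s. \<not> ((r, s) = (-1, 1) \<or> (r, s) = (0, 0) \<or> (r, s) = (1, -1)
                 \<or> (\<exists>k>0. (r, s) = (-1, 1 - k)) \<or> (\<exists>k>0. (r, s) = (0, -k)))
           \<longrightarrow> hodge_component (nexp (cscale z N) \<cdot> F) W N r s = (\<lambda>v. 0)"
proof -
  let ?F = "nexp (cscale z N) \<cdot> F"
  have MHS: "mixed_hodge ?F W"
    using inM unfolding Mcal_def graded_polarized_MHS_def by (blast intro: mixed_hodge_if_is_MHS)
  have N_gR: "N \<in> gR W Q" and N_F: "\<And>p. (*v) N ` F p \<subseteq> F (p - 1)"
    using orbit unfolding nilpotent_orbit_data_def by auto
  have N_W: "N *v x \<in> W k" if "x \<in> W k" for k x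
    using N_gR that unfolding gR_def gC_def by blast
  have N_F': "N *v x \<in> ?F (p - 1)" if "x \<in> ?F p" for p x
    using act_shift_if_commute[OF N_F nexp_commute that] .
  have N_real: "cconj (N *v x) = N *v cconj x" for x
    using N_gR unfolding gR_def by (auto intro: cconj_real_end)
  show ?thesis
    unfolding hodge_type_iff
    using mixed_hodge.hodge_component_N_eq_0[OF MHS N_W N_F' N_real] by blast
qed

end
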